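(* For all $\eta\in\Omega$, it holds that $\mathbb H(\eta)\ge-2L\mathscr N_0+L$. Moreover, equality holds if and only if $\eta=\sigma^k$ for some $k\in\mathbb T_K$. Consequently, the set $\mathcal S$ of minimizers of $\mathbb H$ on $\Omega$ is $\mathcal S=\{\sigma^k:k\in\mathbb T_K\}$.
   Context: Let $K>L$ be positive integers, $\mathbb T_n=\mathbb Z/n\mathbb Z=\{0,\dots,n-1\}$, $V=\mathbb T_K\times\mathbb T_L$ the two-dimensional periodic square lattice, and $E$ the set of unordered nearest-neighbor bonds in $V$. Let $\mathscr N_0$ be an integer with $\frac L4<\mathscr N_0<\frac K2$, and $\mathscr N=L\mathscr N_0$. The configuration space is $\Omega=\{\eta\in\{0,1\}^V:\sum_{x\in V}\eta(x)=\mathscr N\}$, and the Hamiltonian is $\mathbb H(\eta)=-\sum_{\{x,y\}\in E}\eta(x)\eta(y)$. For $k\in\mathbb T_K$, $\mathfrak c^k:=\{k\}\times\mathbb T_L$ is the $k$-th column, and $\sigma^k\in\Omega$ is the configuration with $\{x\in V:\sigma^k(x)=1\}=\mathfrak c^k\cup\mathfrak c^{k+1}\cup\cdots\cup\mathfrak c^{k+\mathscr N_0-1}$.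
   Formalization: For L = 1 or 2 nearest-neighbor bonds are counted with multiplicity (double bonds, loops) as in the quotient of the square lattice, since with a plain set of bonds equality is never attained there; for L ≥ 3 the bonds are exactly the set E. *)

theory Defs
  imports "HOL-Library.Multiset" "HOL-Library.FuncSet" Complex_Main
begin

type_synonym site = "nat \<times> nat"
type_synonym config = "site \<Rightarrow> nat"

definition sites :: "nat \<Rightarrow> nat \<Rightarrow> site set" where
  "sites K L = {..<K} \<times> {..<L}"

definition right :: "nat \<Rightarrow> site \<Rightarrow> site" where
  "right K x = (Suc (fst x) mod K, snd x)"

definition up :: "nat \<Rightarrow> site \<Rightarrow> site" where
  "up L x = (fst x, Suc (snd x) mod L)"

text \<open>
  The torus is the quotient of the square lattice by the translations in
  \<open>K\<int> \<times> L\<int>\<close>, so every site starts exactly one horizontal and one vertical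
  bond. An unordered bond between \<open>x\<close> and \<open>y\<close> is the multiset \<open>{#x, y#}\<close>.
  If both sides are at least 3 no bond is repeated and none is a loop, and the bonds
  are simply the set of unordered nearest-neighbour pairs (lemma \<open>bonds_eq_mset_set\<close>).
  The multiplicities matter only for a side of length 2 (double bonds) or 1 (loops).
  They are kept there, since without them the energy of a full column of length
  \<open>L \<le> 2\<close> would not be \<open>-L\<close>, and the strips of full columns would not have the
  energy \<open>-2 L N0 + L\<close>.
\<close>
definition bonds :: "nat \<Rightarrow> nat \<Rightarrow> site multiset multiset" where
  "bonds K L =
     {#{#x, right K x#}. x \<in># mset_set (sites K L)#} +
     {#{#x, up L x#}. x \<in># mset_set (sites K L)#}"

definition nearest_neighbours :: "nat \<Rightarrow> nat \<Rightarrow> site \<Rightarrow> site \<Rightarrow> bool" where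
  "nearest_neighbours K L x y \<longleftrightarrow>
     y = right K x \<or> x = right K y \<or> y = up L x \<or> x = up L y"

lemma Suc_mod_neq:
  assumes "3 \<le> n" "i < n"
  shows "Suc i mod n \<noteq> i" "Suc (Suc i mod n) mod n \<noteq> i"
  using assms by (auto simp: mod_Suc)

lemma bonds_eq_mset_set:
  assumes "3 \<le> K" "3 \<le> L"
  shows "bonds K L = mset_set {{#x, y#} | x y.
           x \<in> sites K L \<and> y \<in> sites K L \<and> nearest_neighbours K L x y}"
proof -
  let ?V = "sites K L"
  let ?f = "\<lambda>x. {#x, right K x#}" and ?g = "\<lambda>x. {#x, up L x#}"
  have fin: "finite ?V" by (simp add: sites_def)
  have f: "inj_on ?f ?V"
    using Suc_mod_neq[OF assms(1)]
    by (auto simp: inj_on_def sites_def right_def add_eq_conv_ex)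
  have g: "inj_on ?g ?V"
    using Suc_mod_neq[OF assms(2)]
    by (auto simp: inj_on_def sites_def up_def add_eq_conv_ex)
  have disj: "?f ` ?V \<inter> ?g ` ?V = {}"
    using Suc_mod_neq[OF assms(1)] Suc_mod_neq[OF assms(2)]
    by (auto simp: sites_def right_def up_def add_eq_conv_ex)
  have cl: "right K x \<in> ?V" "up L x \<in> ?V" if "x \<in> ?V" for x
    using that assms by (auto simp: sites_def right_def up_def)
  have "?f ` ?V \<union> ?g ` ?V =
      {{#x, y#} | x y. x \<in> ?V \<and> y \<in> ?V \<and> nearest_neighbours K L x y}" (is "?A = ?B")
  proof
    show "?A \<subseteq> ?B"
      unfolding nearest_neighbours_def using cl by blast
    show "?B \<subseteq> ?A"
    proof
      fix e assume "e \<in> ?B"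
      then obtain x y where e: "e = {#x, y#}" "e = {#y, x#}" "x \<in> ?V" "y \<in> ?V"
        and n: "nearest_neighbours K L x y"
        by (auto simp: add_mset_commute)
      from n e show "e \<in> ?A"
        unfolding nearest_neighbours_def by blast
    qed
  qed
  moreover have "bonds K L = mset_set (?f ` ?V \<union> ?g ` ?V)"
    unfolding bonds_def using f g fin disj
    by (simp add: image_mset_mset_set mset_set_Union)
  ultimately show ?thesis by simp
qed

definition configs :: "nat \<Rightarrow> nat \<Rightarrow> nat \<Rightarrow> config set" where
  "configs K L N = {\<eta> \<in> sites K L \<rightarrow>\<^sub>E {0, 1}. (\<Sum>x\<in>sites K L. \<eta> x) = N}"

definition hamiltonian :: "nat \<Rightarrow> nat \<Rightarrow> config \<Rightarrow> int" where
  "hamiltonian K L \<eta> = - int (\<Sum>e\<in>#bonds K L. \<Prod>x\<in>#e. \<eta> x)"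

definition column :: "nat \<Rightarrow> nat \<Rightarrow> site set" where
  "column L k = {k} \<times> {..<L}"

definition strip :: "nat \<Rightarrow> nat \<Rightarrow> nat \<Rightarrow> nat \<Rightarrow> config" where
  "strip K L N0 k =
     (\<lambda>x\<in>sites K L. if x \<in> (\<Union>i<N0. column L ((k + i) mod K)) then 1 else 0)"

definition minimizers :: "nat \<Rightarrow> nat \<Rightarrow> nat \<Rightarrow> config set" where
  "minimizers K L N = {\<eta>. is_arg_min (hamiltonian K L) (\<lambda>\<xi>. \<xi> \<in> configs K L N) \<eta>}"

end

theory Submission imports Defs begin

text \<open>
  Every occupied site starts two bonds, so the energy is \<open>-2N\<close> plus the number of bonds
  leading from an occupied site to an empty right or upper neighbour. A row or column that
  is neither full nor empty contributes at least one such bond. If no row is constant, the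
  rows contribute at least \<open>L\<close>, and exactly \<open>L\<close> bonds in total force all columns to be
  constant and every row to be a single interval. If some row is constant, the total exceeds
  \<open>L\<close>: with a full row, use \<open>N0 < K/2\<close> to bound the number of full rows and columns;
  otherwise the particles lie in a \<open>p \<times> q\<close> box with \<open>p\<close> and \<open>q\<close> the numbers of nonconstant
  rows and columns, and \<open>(p + q)\<^sup>2 \<ge> 4pq \<ge> 4 L N0 > L\<^sup>2\<close>.
\<close>

section \<open>Cyclic words and their descents\<close>

text \<open>The step is cyclic. For \<open>n = 1\<close> the set is empty, in accordance with a bond
  that is a loop.\<close>

definition descents :: "nat \<Rightarrow> (nat \<Rightarrow> bool) \<Rightarrow> nat set" where
  "descents n P = {i. i < n \<and> P i \<and> \<not> P (Suc i mod n)}"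

lemma finite_descents [simp]: "finite (descents n P)"
  by (simp add: descents_def)

lemma upward_closed_from_Suc:
  fixes t :: nat
  assumes "\<And>s. Suc s < n \<Longrightarrow> Q s \<Longrightarrow> Q (Suc s)" "Q t" "t \<le> u" "u < n"
  shows "Q u"
  using assms(3,4) by (induction u rule: dec_induct) (use assms in auto)

text \<open>The added \<open>n\<close> keeps the natural subtraction from truncating, so
  \<open>(i + n - q) mod n\<close> is the number of cyclic steps from \<open>q\<close> to
  \<open>i\<close>.\<close>

lemma add_sub_mod:
  fixes q i n :: nat
  assumes "q < n" "i < n"
  shows "(q + (i + n - q) mod n) mod n = i"
  using assms by (simp add: mod_add_right_eq)

lemma add_mod_inj:
  fixes x y k n :: nat
  assumes "x < n" "y < n" "(k + x) mod n = (k + y) mod n"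
  shows "x = y"
  using assms
proof (induction x y rule: linorder_wlog)
  case (le x y)
  then have "n dvd (k + y) - (k + x)"
    using mod_eq_dvd_iff_nat[of "k + x" "k + y" n] by simp
  then show ?case using le nat_dvd_not_less[of "y - x" n] by fastforce
qed simp

text \<open>Without a descent, truth at \<open>i\<close> is passed on step by step around the whole
  cycle and reaches \<open>j\<close>.\<close>

lemma descents_nonempty:
  assumes "i < n" "P i" "j < n" "\<not> P j"
  shows "descents n P \<noteq> {}"
proof
  assume e: "descents n P = {}"
  define Q where "Q t \<longleftrightarrow> P ((i + t) mod n)" for t
  have "Q (Suc s)" if "Q s" for s
  proof -
    have "(i + s) mod n < n" using assms by simp
    then have "P (Suc ((i + s) mod n) mod n)"
      using e that unfolding descents_def Q_def by blast
    then show ?thesis by (simp add: Q_def mod_Suc_eq)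
  qed
  moreover have "Q 0" using assms by (simp add: Q_def)
  moreover have "(j + n - i) mod n < n" using assms by simp
  ultimately have "Q ((j + n - i) mod n)"
    using upward_closed_from_Suc[of n Q 0] assms(1) by blast
  then show False using assms by (simp add: Q_def add_sub_mod)
qed

text \<open>Cut the cycle just after its only descent. Read from there, the word can only switch
  from false to true, so the true positions form a final segment.\<close>

lemma single_descent_interval:
  assumes "card (descents n P) = 1"
  obtains k m where "k < n" "m \<le> n"
    "\<And>i. i < n \<Longrightarrow> P i \<longleftrightarrow> i \<in> (\<lambda>j. (k + j) mod n) ` {..<m}"
proof -
  obtain d where d: "descents n P = {d}" using assms card_1_singletonE by blast
  then have dn: "d < n" and Pd: "P d" and Psd: "\<not> P (Suc d mod n)"
    by (auto simp: descents_def)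
  define q where "q = Suc d mod n"
  have q: "q < n" using dn by (simp add: q_def)
  define Q where "Q t \<longleftrightarrow> P ((q + t) mod n)" for t
  \<comment> \<open>A failure would be a descent at \<open>q + s\<close>, hence \<open>d\<close>
    itself; but then \<open>q + Suc s\<close> is again \<open>q\<close>, impossible for
    \<open>0 < Suc s < n\<close>.\<close>
  have step: "Q (Suc s)" if "Q s" "Suc s < n" for s
  proof (rule ccontr)
    assume "\<not> Q (Suc s)"
    then have "(q + s) mod n \<in> descents n P"
      using that by (simp add: descents_def Q_def mod_Suc_eq)
    then have "(q + s) mod n = d" using d by simp
    then have "(q + Suc s) mod n = (q + 0) mod n"
      using q mod_Suc_eq[of "q + s" n] by (simp add: q_def)
    then show False
      using add_mod_inj[of "Suc s" n 0 q] that by simp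
  qed
  \<comment> \<open>The last position of the cut cycle is \<open>d\<close>, where \<open>P\<close>
    holds. Hence the least element \<open>t0\<close> below exists.\<close>
  have last: "Q (n - 1)"
  proof -
    have "(q + (n - 1)) mod n = (Suc d + (n - 1)) mod n"
      unfolding q_def by (simp add: mod_add_left_eq)
    also have "\<dots> = d" using dn by simp
    finally show ?thesis using Pd by (simp add: Q_def)
  qed
  define t0 where "t0 = (LEAST t. Q t)"
  have Qt0: "Q t0" and t0: "t0 \<le> n - 1" and least: "\<And>t. Q t \<Longrightarrow> t0 \<le> t"
    unfolding t0_def using last by (auto intro: LeastI Least_le)
  have Q: "Q t \<longleftrightarrow> t0 \<le> t" if "t < n" for t
    using upward_closed_from_Suc[of n Q t0 t] step Qt0 that least by blast
  show ?thesis
  proof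
    show "(q + t0) mod n < n" "n - t0 \<le> n" using dn by auto
    fix i assume i: "i < n"
    define t where "t = (i + n - q) mod n"
    have t: "t < n" "(q + t) mod n = i"
      using q i by (simp_all add: t_def add_sub_mod)
    show "P i \<longleftrightarrow> i \<in> (\<lambda>j. ((q + t0) mod n + j) mod n) ` {..<n - t0}"
    proof
      assume "P i"
      then have "t0 \<le> t" using Q[of t] t by (simp add: Q_def)
      then have "i = ((q + t0) mod n + (t - t0)) mod n" "t - t0 < n - t0"
        using t mod_add_left_eq[of "q + t0" n "t - t0"] by simp_all
      then show "i \<in> (\<lambda>j. ((q + t0) mod n + j) mod n) ` {..<n - t0}" by blast
    next
      assume "i \<in> (\<lambda>j. ((q + t0) mod n + j) mod n) ` {..<n - t0}"
      then obtain j where j: "j < n - t0" "i = (q + (t0 + j)) mod n"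
        by (auto simp: mod_add_left_eq add.assoc)
      then show "P i" using Q[of "t0 + j"] by (simp add: Q_def)
    qed
  qed
qed

lemma inj_on_rotation: "inj_on (\<lambda>j. (k + j) mod n) {..<n::nat}"
  by (rule inj_onI) (use add_mod_inj in auto)

lemma card_rotated_interval:
  fixes k m n :: nat
  assumes "m \<le> n"
  shows "card ((\<lambda>j. (k + j) mod n) ` {..<m}) = m"
  using card_image[OF inj_on_subset[OF inj_on_rotation]] assms by simp

text \<open>Only the last position of the arc can be followed by one outside it. For
  \<open>m = 0\<close> there are no descents, so the truncated \<open>m - 1\<close> is
  harmless.\<close>

lemma card_descents_rotated_interval:
  assumes "\<And>i. i < n \<Longrightarrow> P i \<longleftrightarrow> i \<in> (\<lambda>j. (k + j) mod n) ` {..<m}"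
  shows "card (descents n P) \<le> 1"
proof -
  have "descents n P \<subseteq> {(k + (m - 1)) mod n}"
  proof
    fix i assume i: "i \<in> descents n P"
    then have n: "0 < n" and "i \<in> (\<lambda>j. (k + j) mod n) ` {..<m}"
      using assms by (auto simp: descents_def)
    then obtain j where j: "j < m" "i = (k + j) mod n" by auto
    have "\<not> P ((k + Suc j) mod n)"
      using i j by (simp add: descents_def mod_Suc_eq)
    then have "(k + Suc j) mod n \<notin> (\<lambda>j. (k + j) mod n) ` {..<m}"
      using assms[of "(k + Suc j) mod n"] n by simp
    then have "\<not> Suc j < m" by blast
    then have "j = m - 1" using j by simp
    then show "i \<in> {(k + (m - 1)) mod n}" using j by simp
  qed
  then show ?thesis using card_mono[of "{(k + (m - 1)) mod n}"] by simp
qed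

section \<open>Lower bound for the boundary and its equality case\<close>

definition occupied :: "nat \<Rightarrow> nat \<Rightarrow> (nat \<Rightarrow> nat \<Rightarrow> bool) \<Rightarrow> site set" where
  "occupied K L X = {(i, j). i < K \<and> j < L \<and> X i j}"

text \<open>On each cyclic line the exits from the occupied set are as many as the entries, so this
  is half the perimeter of the set on the torus.\<close>

definition boundary :: "nat \<Rightarrow> nat \<Rightarrow> (nat \<Rightarrow> nat \<Rightarrow> bool) \<Rightarrow> nat" where
  "boundary K L X =
     (\<Sum>j<L. card (descents K (\<lambda>i. X i j))) + (\<Sum>i<K. card (descents L (X i)))"

lemma finite_occupied [simp]: "finite (occupied K L X)"
  by (rule finite_subset[of _ "{..<K} \<times> {..<L}"]) (auto simp: occupied_def)

lemma card_le_sum_card_descents: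
  assumes "A \<subseteq> {..<n::nat}"
    "\<And>a. a \<in> A \<Longrightarrow> \<exists>i<m. f a i" "\<And>a. a \<in> A \<Longrightarrow> \<exists>i<m. \<not> f a i"
  shows "card A \<le> (\<Sum>a<n. card (descents m (f a)))"
proof -
  have "card A = (\<Sum>a\<in>A. 1)" by simp
  also have "\<dots> \<le> (\<Sum>a\<in>A. card (descents m (f a)))"
  proof (rule sum_mono)
    fix a assume "a \<in> A"
    then have "descents m (f a) \<noteq> {}"
      using assms(2,3) descents_nonempty[of _ m "f a"] by metis
    then show "1 \<le> card (descents m (f a))"
      by (simp add: Suc_le_eq card_gt_0_iff)
  qed
  also have "\<dots> \<le> (\<Sum>a<n. card (descents m (f a)))"
    by (rule sum_mono2) (use assms in auto)
  finally show ?thesis .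
qed

text \<open>Once \<open>b = a + d\<close>, the two sides differ by the square of
  \<open>d\<close>.\<close>

lemma four_mult_le_sum_square: "4 * (a * b) \<le> (a + b)\<^sup>2" for a b :: nat
proof (induction a b rule: linorder_wlog)
  case (le a b)
  then obtain d where "b = a + d" using le_Suc_ex by blast
  then show ?case by (simp add: power2_eq_square algebra_simps)
qed (simp add: ac_simps)

lemma boundary_gt_if_constant_row:
  assumes "0 < L" "L < K" "L < 4 * N0" "2 * N0 < K"
    and N: "card (occupied K L X) = L * N0"
    and j: "j < L" and const: "(\<forall>i<K. X i j) \<or> (\<forall>i<K. \<not> X i j)"
  shows "L < boundary K L X"
proof -
  note rows = card_le_sum_card_descents[where f = "\<lambda>j i. X i j" and n = L and m = K]
  note cols = card_le_sum_card_descents[where f = X and n = K and m = L]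
  show ?thesis
  proof (cases "\<exists>j<L. \<forall>i<K. X i j")
    case full: True
    show ?thesis
    proof (cases "\<exists>j<L. \<forall>i<K. \<not> X i j")
      case True
      \<comment> \<open>Every column meets both the full row and the empty one, so all
        \<open>K > L\<close> columns are nonconstant.\<close>
      have "card {..<K} \<le> (\<Sum>i<K. card (descents L (X i)))"
        by (rule cols) (use full True in auto)
      then show ?thesis using assms unfolding boundary_def by simp
    next
      case False
      define A where "A = {j. j < L \<and> (\<forall>i<K. X i j)}"
      define B where "B = {i. i < K \<and> (\<forall>j<L. X i j)}"
      have AB: "A \<subseteq> {..<L}" "B \<subseteq> {..<K}" by (auto simp: A_def B_def)
      then have fin: "finite A" "finite B" using finite_subset by blast+
      have "card ({..<K} \<times> A) \<le> card (occupied K L X)"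
        by (rule card_mono[OF finite_occupied]) (auto simp: occupied_def A_def)
      \<comment> \<open>The doubling makes \<open>2 * N0 < K\<close> applicable: fewer than half of
        the rows are full.\<close>
      then have "2 * (K * card A) \<le> L * (2 * N0)"
        using N by (simp add: card_cartesian_product)
      also have "\<dots> < L * K" using assms by simp
      finally have a: "2 * card A < L" using assms by (simp add: mult.commute mult.left_commute)
      have "card (B \<times> {..<L}) \<le> card (occupied K L X)"
        by (rule card_mono[OF finite_occupied]) (auto simp: occupied_def B_def)
      then have b: "card B \<le> N0"
        using N assms by (simp add: card_cartesian_product mult.commute)
      have "card ({..<L} - A) \<le> (\<Sum>j<L. card (descents K (\<lambda>i. X i j)))"
        by (rule rows) (use False in \<open>auto simp: A_def\<close>)
      moreover have "card ({..<K} - B) \<le> (\<Sum>i<K. card (descents L (X i)))"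
        by (rule cols) (use full in \<open>auto simp: B_def\<close>)
      ultimately have "(L - card A) + (K - card B) \<le> boundary K L X"
        unfolding boundary_def using AB fin by (simp add: card_Diff_subset)
      \<comment> \<open>More than \<open>L / 2\<close> rows are nonconstant, and so are at least
        \<open>K - N0 > K / 2 > L / 2\<close> columns.\<close>
      then show ?thesis using a b assms by linarith
    qed
  next
    case nofull: False
    then have empty: "\<exists>j<L. \<forall>i<K. \<not> X i j" using const j by blast
    \<comment> \<open>Nonempty now means nonconstant: no row is full, and every column meets an
      empty row.\<close>
    define A where "A = {j. j < L \<and> (\<exists>i<K. X i j)}"
    define B where "B = {i. i < K \<and> (\<exists>j<L. X i j)}"
    have "card A \<le> (\<Sum>j<L. card (descents K (\<lambda>i. X i j)))"
      by (rule rows) (use nofull in \<open>auto simp: A_def\<close>)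
    moreover have "card B \<le> (\<Sum>i<K. card (descents L (X i)))"
      by (rule cols) (use empty in \<open>auto simp: B_def\<close>)
    ultimately have le: "card A + card B \<le> boundary K L X"
      unfolding boundary_def by simp
    have "card (occupied K L X) \<le> card (B \<times> A)"
      by (rule card_mono) (auto simp: occupied_def A_def B_def)
    then have "4 * (L * N0) \<le> 4 * (card A * card B)"
      using N by (simp add: card_cartesian_product mult.commute)
    also have "\<dots> \<le> (card A + card B)\<^sup>2"
      by (rule four_mult_le_sum_square)
    also have "\<dots> \<le> (boundary K L X)\<^sup>2" using le by (simp add: power_mono)
    finally have "L * (4 * N0) \<le> (boundary K L X)\<^sup>2" by simp
    moreover have "L * L < L * (4 * N0)" using assms by simp
    ultimately have "L\<^sup>2 < (boundary K L X)\<^sup>2"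
      unfolding power2_eq_square by linarith
    then show ?thesis using power_less_imp_less_base by blast
  qed
qed

lemma boundary_minimal:
  assumes "0 < L" "L < K" "L < 4 * N0" "2 * N0 < K"
    and N: "card (occupied K L X) = L * N0"
  shows "L \<le> boundary K L X"
    and "boundary K L X = L \<Longrightarrow>
      \<exists>k<K. \<forall>i<K. \<forall>j<L. X i j \<longleftrightarrow> i \<in> (\<lambda>t. (k + t) mod K) ` {..<N0}"
proof -
  have rows: "L \<le> (\<Sum>j<L. card (descents K (\<lambda>i. X i j)))"
    if "\<not> (\<exists>j<L. (\<forall>i<K. X i j) \<or> (\<forall>i<K. \<not> X i j))"
    using card_le_sum_card_descents[of "{..<L}" L K "\<lambda>j i. X i j"] that by auto
  show "L \<le> boundary K L X"
    using rows boundary_gt_if_constant_row[OF assms] unfolding boundary_def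
    by (meson less_imp_le trans_le_add1)
  assume eq: "boundary K L X = L"
  then have "\<not> (\<exists>j<L. (\<forall>i<K. X i j) \<or> (\<forall>i<K. \<not> X i j))"
    using boundary_gt_if_constant_row[OF assms] by auto
  \<comment> \<open>The rows alone already account for \<open>L\<close>, which leaves nothing for
    the columns.\<close>
  from rows[OF this] have r: "(\<Sum>j<L. card (descents K (\<lambda>i. X i j))) = L"
    and c: "(\<Sum>i<K. card (descents L (X i))) = 0"
    using eq unfolding boundary_def by linarith+
  have const: "X i j \<longleftrightarrow> X i 0" if "i < K" "j < L" for i j
  proof -
    have "descents L (X i) = {}" using c that by simp
    then show ?thesis
      using descents_nonempty[of _ L "X i"] that assms(1) by blast
  qed
  \<comment> \<open>Constant columns make all rows equal, so the total \<open>L\<close> is shared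
    evenly and each row has exactly one descent.\<close>
  have "descents K (\<lambda>i. X i j) = descents K (\<lambda>i. X i 0)" if "j \<in> {..<L}" for j
    unfolding descents_def
  proof (rule Collect_cong)
    fix i
    have "X i j \<longleftrightarrow> X i 0" "X (Suc i mod K) j \<longleftrightarrow> X (Suc i mod K) 0" if "i < K"
      using const[of i j] const[of "Suc i mod K" j] \<open>j \<in> {..<L}\<close> that by auto
    then show "i < K \<and> X i j \<and> \<not> X (Suc i mod K) j \<longleftrightarrow> i < K \<and> X i 0 \<and> \<not> X (Suc i mod K) 0"
      by blast
  qed
  then have "(\<Sum>j<L. card (descents K (\<lambda>i. X i j))) = (\<Sum>j<L. card (descents K (\<lambda>i. X i 0)))"
    by (intro sum.cong refl arg_cong[where f = card])
  then have "L * card (descents K (\<lambda>i. X i 0)) = L * 1"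
    using r by (simp only: sum_constant card_lessThan mult.right_neutral of_nat_id)
  then have "card (descents K (\<lambda>i. X i 0)) = 1" using assms(1) by simp
  then obtain k m where k: "k < K" "m \<le> K"
    "\<And>i. i < K \<Longrightarrow> X i 0 \<longleftrightarrow> i \<in> (\<lambda>j. (k + j) mod K) ` {..<m}"
    by (rule single_descent_interval) blast
  have strip: "X i j \<longleftrightarrow> i \<in> (\<lambda>j. (k + j) mod K) ` {..<m}" if "i < K" "j < L" for i j
    using const[OF that] k(3)[OF that(1)] by simp
  \<comment> \<open>The number of particles determines the width \<open>m\<close> of the
    strip.\<close>
  have "occupied K L X = (\<lambda>j. (k + j) mod K) ` {..<m} \<times> {..<L}"
    using k by (auto simp: occupied_def strip)
  then have "card (occupied K L X) = m * L"
    using k(2) by (simp add: card_cartesian_product card_rotated_interval)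
  then have "m = N0" using N assms(1) by simp
  then have "\<forall>i<K. \<forall>j<L. X i j \<longleftrightarrow> i \<in> (\<lambda>t. (k + t) mod K) ` {..<N0}"
    using strip by simp
  then show "\<exists>k<K. \<forall>i<K. \<forall>j<L. X i j \<longleftrightarrow> i \<in> (\<lambda>t. (k + t) mod K) ` {..<N0}"
    using k(1) by blast
qed

section \<open>The energy in terms of the boundary\<close>

text \<open>The identity holds term by term: an occupied position is followed either by an occupied
  one, giving product 1, or by an empty one, giving a descent.\<close>

lemma sum_cyclic_products:
  fixes f :: "nat \<Rightarrow> nat"
  assumes "\<And>i. i < n \<Longrightarrow> f i \<in> {0, 1}"
  shows "(\<Sum>i<n. f i * f (Suc i mod n)) + card (descents n (\<lambda>i. f i = 1)) = (\<Sum>i<n. f i)"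
proof -
  have "card (descents n (\<lambda>i. f i = 1)) =
      (\<Sum>i<n. if f i = 1 \<and> f (Suc i mod n) \<noteq> 1 then 1 else 0)"
    by (simp add: descents_def sum.If_cases Int_def)
  then have "(\<Sum>i<n. f i * f (Suc i mod n)) + card (descents n (\<lambda>i. f i = 1)) =
      (\<Sum>i<n. f i * f (Suc i mod n) + (if f i = 1 \<and> f (Suc i mod n) \<noteq> 1 then 1 else 0))"
    by (simp add: sum.distrib)
  also have "\<dots> = (\<Sum>i<n. f i)"
  proof (rule sum.cong)
    fix i assume "i \<in> {..<n}"
    then have "f i \<in> {0, 1}" "f (Suc i mod n) \<in> {0, 1}"
      using assms[of i] assms[of "Suc i mod n"] by auto
    then show "f i * f (Suc i mod n) + (if f i = 1 \<and> f (Suc i mod n) \<noteq> 1 then 1 else 0) = f i"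
      by auto
  qed simp
  finally show ?thesis .
qed

lemma config_values:
  assumes "\<eta> \<in> configs K L N" "i < K" "j < L"
  shows "\<eta> (i, j) \<in> {0, 1}"
  using assms by (auto simp: configs_def sites_def dest!: PiE_mem)

lemma card_occupied_config:
  assumes "\<eta> \<in> configs K L N"
  shows "card (occupied K L (\<lambda>i j. \<eta> (i, j) = 1)) = N"
proof -
  have "N = (\<Sum>x\<in>sites K L. \<eta> x)" using assms by (simp add: configs_def)
  also have "\<dots> = (\<Sum>x\<in>sites K L. if \<eta> x = 1 then 1 else 0)"
    using config_values[OF assms] by (intro sum.cong) (auto simp: sites_def)
  also have "\<dots> = card (sites K L \<inter> {x. \<eta> x = 1})"
    by (simp add: sum.If_cases sites_def)
  also have "sites K L \<inter> {x. \<eta> x = 1} = occupied K L (\<lambda>i j. \<eta> (i, j) = 1)"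
    by (auto simp: sites_def occupied_def)
  finally show ?thesis by simp
qed

text \<open>The cyclic identity is summed over all rows for the horizontal bonds and over all
  columns for the vertical ones; each direction counts every particle once, whence
  \<open>2 * N\<close>.\<close>

lemma hamiltonian_eq_boundary:
  assumes "\<eta> \<in> configs K L N"
  shows "hamiltonian K L \<eta> = - 2 * int N + int (boundary K L (\<lambda>i j. \<eta> (i, j) = 1))"
proof -
  have N: "(\<Sum>x\<in>sites K L. \<eta> x) = N" using assms by (simp add: configs_def)
  have ij: "(\<Sum>x\<in>sites K L. g x) = (\<Sum>i<K. \<Sum>j<L. g (i, j))" for g :: "site \<Rightarrow> nat"
    by (simp add: sites_def sum.cartesian_product)
  have ji: "(\<Sum>x\<in>sites K L. g x) = (\<Sum>j<L. \<Sum>i<K. g (i, j))" for g :: "site \<Rightarrow> nat"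
    unfolding ij by (rule sum.swap)
  have "(\<Sum>x\<in>sites K L. \<eta> x * \<eta> (right K x))
      + (\<Sum>j<L. card (descents K (\<lambda>i. \<eta> (i, j) = 1))) = (\<Sum>x\<in>sites K L. \<eta> x)"
    unfolding ji right_def sum.distrib[symmetric]
    using config_values[OF assms]
    by (intro sum.cong) (auto intro!: sum_cyclic_products[of K "\<lambda>i. \<eta> (i, _)", simplified])
  moreover have "(\<Sum>x\<in>sites K L. \<eta> x * \<eta> (up L x))
      + (\<Sum>i<K. card (descents L (\<lambda>j. \<eta> (i, j) = 1))) = (\<Sum>x\<in>sites K L. \<eta> x)"
    unfolding ij up_def sum.distrib[symmetric]
    using config_values[OF assms]
    by (intro sum.cong) (auto intro!: sum_cyclic_products[of L "\<lambda>j. \<eta> (_, j)", simplified])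
  moreover have "(\<Sum>e\<in>#bonds K L. \<Prod>x\<in>#e. \<eta> x) =
      (\<Sum>x\<in>sites K L. \<eta> x * \<eta> (right K x)) + (\<Sum>x\<in>sites K L. \<eta> x * \<eta> (up L x))"
    unfolding bonds_def by (simp add: image_mset.compositionality comp_def sum_unfold_sum_mset)
  ultimately have "(\<Sum>e\<in>#bonds K L. \<Prod>x\<in>#e. \<eta> x) + boundary K L (\<lambda>i j. \<eta> (i, j) = 1) = 2 * N"
    using N unfolding boundary_def by linarith
  then show ?thesis unfolding hamiltonian_def by linarith
qed

section \<open>Strips of full columns\<close>

lemma strip_apply:
  assumes "i < K" "j < L"
  shows "strip K L N0 k (i, j) = (if i \<in> (\<lambda>t. (k + t) mod K) ` {..<N0} then 1 else 0)"
  using assms by (auto simp: strip_def column_def sites_def)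

lemma strip_in_configs:
  assumes "N0 \<le> K" "0 < K"
  shows "strip K L N0 k \<in> configs K L (L * N0)"
proof -
  let ?S = "(\<lambda>t. (k + t) mod K) ` {..<N0}"
  have "(\<Sum>x\<in>sites K L. strip K L N0 k x)
      = (\<Sum>i<K. \<Sum>j<L. strip K L N0 k (i, j))"
    by (simp add: sites_def sum.cartesian_product)
  also have "\<dots> = (\<Sum>i<K. \<Sum>j<L. if i \<in> ?S then 1 else 0)"
    by (intro sum.cong refl) (use strip_apply in auto)
  also have "\<dots> = L * (\<Sum>i<K. if i \<in> ?S then 1 else 0)"
    by (simp add: sum_distrib_left)
  also have "(\<Sum>i<K. if i \<in> ?S then 1 else 0) = card ({..<K} \<inter> ?S)"
    by (simp add: sum.If_cases)
  also have "{..<K} \<inter> ?S = ?S" using assms by auto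
  \<comment> \<open>Since \<open>N0 \<le> K\<close>, the columns of the strip do not wrap around
    onto each other.\<close>
  also have "card ?S = N0" using assms by (simp add: card_rotated_interval)
  finally have "(\<Sum>x\<in>sites K L. strip K L N0 k x) = L * N0" .
  moreover have "strip K L N0 k \<in> sites K L \<rightarrow>\<^sub>E {0, 1}"
    by (auto simp: strip_def)
  ultimately show ?thesis by (simp add: configs_def)
qed

text \<open>The upper bound suffices: the general lower bound turns it into equality for the strips
  in question.\<close>

lemma boundary_strip:
  "boundary K L (\<lambda>i j. strip K L N0 k (i, j) = 1) \<le> L"
proof -
  have "card (descents K (\<lambda>i. strip K L N0 k (i, j) = 1)) \<le> 1" if "j < L" for j
    by (rule card_descents_rotated_interval[of _ _ k N0]) (use that strip_apply in auto)
  then have "(\<Sum>j<L. card (descents K (\<lambda>i. strip K L N0 k (i, j) = 1))) \<le> (\<Sum>j<L. 1)"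
    by (intro sum_mono) simp
  moreover have "descents L (\<lambda>j. strip K L N0 k (i, j) = 1) = {}" if "i < K" for i
    using that by (auto simp: descents_def strip_apply)
  ultimately show ?thesis by (simp add: boundary_def)
qed

text \<open>Configurations are extensional functions, so agreement on \<open>sites K L\<close> is
  equality.\<close>

lemma config_eq_strip:
  assumes "\<eta> \<in> configs K L N"
    and "\<forall>i<K. \<forall>j<L. \<eta> (i, j) = 1 \<longleftrightarrow> i \<in> (\<lambda>t. (k + t) mod K) ` {..<N0}"
  shows "\<eta> = strip K L N0 k"
proof (rule PiE_ext)
  show "\<eta> \<in> sites K L \<rightarrow>\<^sub>E {0, 1}" using assms by (simp add: configs_def)
  show "strip K L N0 k \<in> sites K L \<rightarrow>\<^sub>E {0, 1}" by (auto simp: strip_def)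
  fix x assume "x \<in> sites K L"
  then obtain i j where "x = (i, j)" "i < K" "j < L" by (auto simp: sites_def)
  then show "\<eta> x = strip K L N0 k x"
    using assms(2) config_values[OF assms(1), of i j] by (auto simp: strip_apply)
qed

section \<open>Minimal energy and the ground states\<close>

theorem theorem3p2:
  fixes K L N0 :: nat
  assumes "0 < L" and "L < K"
    and "real L / 4 < real N0" and "real N0 < real K / 2"
  shows "(\<forall>\<eta>\<in>configs K L (L * N0).
            hamiltonian K L \<eta> \<ge> - 2 * int L * int N0 + int L \<and>
            (hamiltonian K L \<eta> = - 2 * int L * int N0 + int L \<longleftrightarrow>
               (\<exists>k<K. \<eta> = strip K L N0 k))) \<and>
         minimizers K L (L * N0) = {strip K L N0 k | k. k < K}"
proof -
  let ?C = "configs K L (L * N0)" and ?E = "- 2 * int L * int N0 + int L"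
  have N0: "L < 4 * N0" "2 * N0 < K" using assms(3,4) by linarith+
  note minimal = boundary_minimal[OF assms(1,2) N0 card_occupied_config]
  have ham: "hamiltonian K L \<eta> = - 2 * int L * int N0 + int (boundary K L (\<lambda>i j. \<eta> (i, j) = 1))"
    if "\<eta> \<in> ?C" for \<eta>
    using hamiltonian_eq_boundary[OF that] by simp
  have ge: "?E \<le> hamiltonian K L \<eta>" if "\<eta> \<in> ?C" for \<eta>
    using ham[OF that] minimal(1)[OF that] by simp
  have strip: "strip K L N0 k \<in> ?C" for k
    using strip_in_configs N0 assms by simp
  have strip_ham: "hamiltonian K L (strip K L N0 k) = ?E" for k
    using ham[OF strip] ge[OF strip, of k] boundary_strip[of K L N0 k] by simp
  have eq: "hamiltonian K L \<eta> = ?E \<longleftrightarrow> (\<exists>k<K. \<eta> = strip K L N0 k)" if "\<eta> \<in> ?C" for \<eta>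
  proof
    assume "hamiltonian K L \<eta> = ?E"
    then have "boundary K L (\<lambda>i j. \<eta> (i, j) = 1) = L" using ham[OF that] by simp
    from minimal(2)[OF that this] show "\<exists>k<K. \<eta> = strip K L N0 k"
      using config_eq_strip[OF that] by blast
  qed (use strip_ham in auto)
  \<comment> \<open>The lower bound \<open>?E\<close> is attained, for instance by the strip
    starting at column 0, so minimizing means having energy \<open>?E\<close>.\<close>
  have "\<eta> \<in> minimizers K L (L * N0) \<longleftrightarrow> \<eta> \<in> ?C \<and> hamiltonian K L \<eta> = ?E" for \<eta>
    unfolding minimizers_def is_arg_min_linorder mem_Collect_eq
    using ge strip[of 0] strip_ham[of 0] by (metis order_antisym)
  then have "minimizers K L (L * N0) = {strip K L N0 k | k. k < K}"
    using eq strip by blast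
  then show ?thesis using ge eq by blast
qed

end
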